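(* Let $\chi: SL_2(\mathbb R)\to\mathbb C$ be the trace function $\chi(A)=\operatorname{tr} A$, and let $\chi_3$ be the function on $SL_2(\mathbb R)^3$ obtained from $\chi$ by the Frobenius construction, that is, $$\chi_3(A,B,C)=\chi(A)\chi(B)\chi(C)-\chi(A)\chi(BC)-\chi(B)\chi(AC)-\chi(C)\chi(AB)+\chi(ABC)+\chi(ACB).$$ Then the Frobenius condition $$\chi_3(A,B,C)=0\quad\text{for all } A,B,C\in SL_2(\mathbb R)$$ implies the Fricke identity: for all $A,B\in SL_2(\mathbb R)$, with $C:=AB$, $$(\operatorname{tr} A)^2+(\operatorname{tr} B)^2+(\operatorname{tr} C)^2=\operatorname{tr} A\,\operatorname{tr} B\,\operatorname{tr} C+\operatorname{tr}(ABA^{-1}B^{-1})+2.$$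
   Context: For a group $G$ and a function $\chi:G\to\mathbb C$ with $\chi(gh)=\chi(hg)$ for all $g,h\in G$, the functions $\chi_k:G^k\to\mathbb C$ are defined by $\chi_1=\chi$ and $\chi_{k+1}(h_0,h_1,\ldots,h_k)=\chi(h_0)\chi_k(h_1,\ldots,h_k)-\sum_{j=1}^k\chi_k(h_1,\ldots,h_0h_j,\ldots,h_k)$, where in the $j$-th summand $h_j$ is replaced by $h_0h_j$. For $k=3$ this gives the explicit formula in the claim. The vanishing $\chi_3\equiv 0$ is the condition satisfied by the character of a 2-dimensional representation (a "2-character"); here it is taken for the canonical 2-dimensional representation. *)

theory Defs
  imports "HOL-Analysis.Analysis" "HOL-Algebra.Group"
begin

text \<open>
  The Frobenius functions of a class function \<open>\<phi>\<close> (the symbol \<open>\<chi>\<close> is the vector binder),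
  with the \<open>k\<close> arguments collected in a list of length \<open>k\<close>.
  The value on the empty list is irrelevant for \<open>k \<ge> 1\<close>.
\<close>

function frobenius :: "('a, 'b) monoid_scheme \<Rightarrow> ('a \<Rightarrow> complex) \<Rightarrow> 'a list \<Rightarrow> complex" where
  "frobenius G \<phi> [] = 1"
| "frobenius G \<phi> [h] = \<phi> h"
| "frobenius G \<phi> (h\<^sub>0 # h\<^sub>1 # hs) =
     \<phi> h\<^sub>0 * frobenius G \<phi> (h\<^sub>1 # hs)
     - (\<Sum>j<length (h\<^sub>1 # hs). frobenius G \<phi> ((h\<^sub>1 # hs)[j := h\<^sub>0 \<otimes>\<^bsub>G\<^esub> ((h\<^sub>1 # hs) ! j)]))"
  by pat_completeness auto
termination
  by (relation "Wellfounded.measure (\<lambda>(G, \<phi>, hs). length hs)") (auto split: nat.split)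

lemma frobenius_3:
  assumes "monoid G"
    and class_fun: "\<And>g h. g \<in> carrier G \<Longrightarrow> h \<in> carrier G \<Longrightarrow> \<phi> (g \<otimes>\<^bsub>G\<^esub> h) = \<phi> (h \<otimes>\<^bsub>G\<^esub> g)"
    and carr: "a \<in> carrier G" "b \<in> carrier G" "c \<in> carrier G"
  shows "frobenius G \<phi> [a, b, c] =
    \<phi> a * \<phi> b * \<phi> c - \<phi> a * \<phi> (b \<otimes>\<^bsub>G\<^esub> c) - \<phi> b * \<phi> (a \<otimes>\<^bsub>G\<^esub> c) - \<phi> c * \<phi> (a \<otimes>\<^bsub>G\<^esub> b)
    + \<phi> (a \<otimes>\<^bsub>G\<^esub> b \<otimes>\<^bsub>G\<^esub> c) + \<phi> (a \<otimes>\<^bsub>G\<^esub> c \<otimes>\<^bsub>G\<^esub> b)"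
proof -
  interpret monoid G by fact
  have "\<phi> (b \<otimes>\<^bsub>G\<^esub> (a \<otimes>\<^bsub>G\<^esub> c)) = \<phi> (a \<otimes>\<^bsub>G\<^esub> c \<otimes>\<^bsub>G\<^esub> b)"
    using carr by (intro class_fun) auto
  then show ?thesis
    by (simp add: numeral_2_eq_2 algebra_simps)
qed

definition SL2R :: "(real^2^2) monoid" where
  "SL2R = \<lparr>carrier = {A. det A = 1}, mult = (**), one = mat 1\<rparr>"

lemma SL2R_simps [simp]:
  "A \<in> carrier SL2R \<longleftrightarrow> det A = 1"
  "A \<otimes>\<^bsub>SL2R\<^esub> B = A ** B"
  "\<one>\<^bsub>SL2R\<^esub> = mat 1"
  by (simp_all add: SL2R_def)

lemma matrix_inv_SL2R:
  fixes A :: "real^2^2"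
  assumes "det A = 1"
  shows "A ** matrix_inv A = mat 1" "matrix_inv A ** A = mat 1" "det (matrix_inv A) = 1"
proof -
  have "invertible A" using assms by (simp add: invertible_det_nz)
  then show 1: "A ** matrix_inv A = mat 1" and "matrix_inv A ** A = mat 1"
    unfolding invertible_def matrix_inv_def by (metis (mono_tags, lifting) someI_ex)+
  have "det A * det (matrix_inv A) = 1"
    using 1 by (metis det_mul det_I)
  then show "det (matrix_inv A) = 1" using assms by simp
qed

lemma group_SL2R: "group SL2R"
proof (rule groupI)
  fix A assume "A \<in> carrier SL2R"
  then show "\<exists>B\<in>carrier SL2R. B \<otimes>\<^bsub>SL2R\<^esub> A = \<one>\<^bsub>SL2R\<^esub>"
    using matrix_inv_SL2R[of A] by auto
qed (auto simp: det_mul matrix_mul_assoc)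

lemma inv_SL2R: "A \<in> carrier SL2R \<Longrightarrow> inv\<^bsub>SL2R\<^esub> A = matrix_inv A"
  using matrix_inv_SL2R[of A] by (intro group.inv_equality[OF group_SL2R]) auto

definition trace_char :: "real^2^2 \<Rightarrow> complex" where
  "trace_char A = complex_of_real (trace A)"

lemma trace_char_class_fun:
  "trace_char (A \<otimes>\<^bsub>SL2R\<^esub> B) = trace_char (B \<otimes>\<^bsub>SL2R\<^esub> A)"
  by (simp add: trace_char_def trace_mul_sym[of A B])

lemma frobenius_3_SL2R:
  assumes "A \<in> carrier SL2R" "B \<in> carrier SL2R" "C \<in> carrier SL2R"
  shows "frobenius SL2R trace_char [A, B, C] =
    trace_char A * trace_char B * trace_char C
    - trace_char A * trace_char (B ** C) - trace_char B * trace_char (A ** C)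
    - trace_char C * trace_char (A ** B)
    + trace_char (A ** B ** C) + trace_char (A ** C ** B)"
  using frobenius_3[where G = SL2R and \<phi> = trace_char, OF group.is_monoid[OF group_SL2R] trace_char_class_fun assms] by simp

end

theory Submission
  imports Defs
begin

text \<open>
  Apply the Frobenius condition to the triple \<open>A, B, A\<inverse>B\<inverse>\<close>. Since the trace on \<open>SL\<^sub>2\<close> is invariant
  under inversion, cyclicity turns the pairwise products into the squares of the traces of
  \<open>A\<close>, \<open>B\<close> and \<open>AB\<close>, while the two triple products become the commutator and the identity.
\<close>

lemma trace_2: "trace (A :: 'a::comm_semiring_1^2^2) = A$1$1 + A$2$2"
  by (simp add: trace_def sum_2)

text \<open>For determinant 1 the inverse is the adjugate, which swaps the two diagonal entries and
  so keeps their sum.\<close>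

lemma trace_matrix_inv_SL2R:
  fixes A :: "real^2^2"
  assumes "det A = 1"
  shows "trace (matrix_inv A) = trace A"
proof -
  define A' :: "real^2^2" where "A' = vector [vector [A$2$2, - A$1$2], vector [- A$2$1, A$1$1]]"
  have "A ** A' = mat 1"
    using assms
    by (simp add: A'_def vec_eq_iff forall_2 matrix_matrix_mult_def sum_2 mat_def vector_2 det_2
        algebra_simps)
  \<comment> \<open>A left inverse and a right inverse of the same matrix coincide.\<close>
  then have "matrix_inv A = A'"
    using matrix_inv_SL2R(2)[OF assms] by (metis matrix_mul_assoc matrix_mul_lid matrix_mul_rid)
  then show ?thesis
    by (simp add: trace_2 A'_def vector_2)
qed

lemma matrix_inv_mult_SL2R:
  assumes "A \<in> carrier SL2R" "B \<in> carrier SL2R"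
  shows "matrix_inv (A ** B) = matrix_inv B ** matrix_inv A"
proof -
  have "A ** B \<in> carrier SL2R"
    using assms by (simp add: det_mul)
  then show ?thesis
    using group.inv_mult_group[OF group_SL2R assms] assms by (simp only: inv_SL2R SL2R_simps(2))
qed

theorem proposition3p5:
  assumes "\<forall>A\<in>carrier SL2R. \<forall>B\<in>carrier SL2R. \<forall>C\<in>carrier SL2R.
             frobenius SL2R trace_char [A, B, C] = 0"
  shows "\<forall>A\<in>carrier SL2R. \<forall>B\<in>carrier SL2R. \<forall>C. C = A \<otimes>\<^bsub>SL2R\<^esub> B \<longrightarrow>
           (trace A)\<^sup>2 + (trace B)\<^sup>2 + (trace C)\<^sup>2 =
           trace A * trace B * trace C
           + trace (A \<otimes>\<^bsub>SL2R\<^esub> B \<otimes>\<^bsub>SL2R\<^esub> inv\<^bsub>SL2R\<^esub> A \<otimes>\<^bsub>SL2R\<^esub> inv\<^bsub>SL2R\<^esub> B) + 2"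
proof (intro ballI allI impI)
  fix A B C
  assume A: "A \<in> carrier SL2R" and B: "B \<in> carrier SL2R" and C: "C = A \<otimes>\<^bsub>SL2R\<^esub> B"
  let ?A' = "matrix_inv A" and ?B' = "matrix_inv B"
  note invA = matrix_inv_SL2R[of A] and invB = matrix_inv_SL2R[of B]
  \<comment> \<open>\<open>D\<close> is the inverse of \<open>B ** A\<close>, not of
    \<open>A ** B\<close>: this order makes \<open>A ** B ** D\<close> the commutator and lets
    \<open>A ** D ** B\<close> collapse.\<close>
  define D where "D = ?A' ** ?B'"
  have D: "D \<in> carrier SL2R"
    using A B invA invB by (simp add: D_def det_mul)
  have "frobenius SL2R trace_char [A, B, D] = 0"
    using assms A B D by blast
  \<comment> \<open>The character is complex-valued; gathering everything under one embedding lets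
    its injectivity give a real identity.\<close>
  then have "complex_of_real (trace A * trace B * trace D - trace A * trace (B ** D)
      - trace B * trace (A ** D) - trace D * trace (A ** B)
      + trace (A ** B ** D) + trace (A ** D ** B)) = 0"
    unfolding frobenius_3_SL2R[OF A B D] by (simp add: trace_char_def)
  then have frob: "trace A * trace B * trace D - trace A * trace (B ** D)
      - trace B * trace (A ** D) - trace D * trace (A ** B)
      + trace (A ** B ** D) + trace (A ** D ** B) = 0"
    by (simp only: of_real_eq_0_iff)
  have "trace D = trace (B ** A)"
    using A B by (simp add: D_def matrix_inv_mult_SL2R[symmetric] trace_matrix_inv_SL2R det_mul)
  then have tD: "trace D = trace C"
    by (simp add: C trace_mul_sym[of A B])
  have "trace (B ** D) = trace (D ** B)"
    by (rule trace_mul_sym)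
  also have "D ** B = ?A'"
    using B invB by (simp add: D_def matrix_mul_assoc[symmetric])
  finally have tBD: "trace (B ** D) = trace A"
    using A by (simp add: trace_matrix_inv_SL2R)
  have AD: "A ** D = ?B'"
    using A invA by (simp add: D_def matrix_mul_assoc)
  have tAD: "trace (A ** D) = trace B"
    using B by (simp add: AD trace_matrix_inv_SL2R)
  \<comment> \<open>The constant 2 of the Fricke identity arises here, as the trace of the 2 by 2
    identity matrix.\<close>
  have tADB: "trace (A ** D ** B) = 2"
    using B invB by (simp add: AD trace_I)
  have tABD: "trace (A ** B ** D) =
      trace (A \<otimes>\<^bsub>SL2R\<^esub> B \<otimes>\<^bsub>SL2R\<^esub> inv\<^bsub>SL2R\<^esub> A \<otimes>\<^bsub>SL2R\<^esub> inv\<^bsub>SL2R\<^esub> B)"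
    by (simp only: D_def inv_SL2R[OF A] inv_SL2R[OF B] SL2R_simps(2) matrix_mul_assoc)
  show "(trace A)\<^sup>2 + (trace B)\<^sup>2 + (trace C)\<^sup>2 =
      trace A * trace B * trace C
      + trace (A \<otimes>\<^bsub>SL2R\<^esub> B \<otimes>\<^bsub>SL2R\<^esub> inv\<^bsub>SL2R\<^esub> A \<otimes>\<^bsub>SL2R\<^esub> inv\<^bsub>SL2R\<^esub> B) + 2"
    \<comment> \<open>The three subtracted products are now the squares of the traces of
      \<open>A\<close>, \<open>B\<close> and \<open>C\<close>.\<close>
    using frob C unfolding tD tBD tAD tADB tABD by (simp add: power2_eq_square)
qed

end
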